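(* Let $\theta>0$ be a constant such that $\|T_N(E)\|\le N^\theta$ for all integers $N\ge2$ and all $E\in\Sigma_\lambda$. Then for every $\xi\in(0,\dim_H\Sigma_\lambda)$ there is a constant $C_\xi>0$ such that for all $N\ge2$, $$\mathcal{I}(N)=\int_{-\infty}^{\infty}\frac{dE}{\|T_N(E)\|^2}\ge\frac{C_\xi}{N^{(\frac1\xi-1)+2\theta}}.$$
   Context: Fibonacci Hamiltonian: fix $\lambda>0$ and $\alpha=\frac{\sqrt5-1}{2}$. The potential is $v(n)=-\lambda\chi_{[1-\alpha,1)}(n\alpha \bmod 1)$, $n\in\mathbb{Z}$ (the phase $\omega=0$ case of $v_\omega(n)=-\lambda\chi_{[1-\alpha,1)}(\omega+n\alpha\bmod1)$). $\Sigma_\lambda\subset\mathbb{R}$ denotes the spectrum of the corresponding discrete Schrödinger operator $(h\psi)(n)=-\psi(n+1)-\psi(n-1)+v(n)\psi(n)$ on $\ell^2(\mathbb{Z})$; it has Hausdorff dimension $\dim_H\Sigma_\lambda\in(0,1)$. $T_N(E)=A_N(E)\cdots A_1(E)$ with $A_n(E)=\begin{pmatrix}v(n)-E&-1\\1&0\end{pmatrix}$, and $\|\cdot\|$ is the operator norm. *)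

theory Defs
  imports "HOL-Analysis.Analysis"
begin

definition fib_alpha :: real where
  "fib_alpha = (sqrt 5 - 1) / 2"

definition fib_pot :: "real \<Rightarrow> int \<Rightarrow> real" where
  "fib_pot lam n = - lam * indicator {1 - fib_alpha..<1} (frac (of_int n * fib_alpha))"

definition l2Z :: "(int \<Rightarrow> complex) set" where
  "l2Z = {\<psi>. (\<lambda>n. (cmod (\<psi> n))\<^sup>2) summable_on UNIV}"

definition l2Z_norm :: "(int \<Rightarrow> complex) \<Rightarrow> real" where
  "l2Z_norm \<psi> = sqrt (\<Sum>\<^sub>\<infinity>n. (cmod (\<psi> n))\<^sup>2)"

definition fib_op :: "real \<Rightarrow> (int \<Rightarrow> complex) \<Rightarrow> (int \<Rightarrow> complex)" where
  "fib_op lam \<psi> = (\<lambda>n. - \<psi> (n + 1) - \<psi> (n - 1) + complex_of_real (fib_pot lam n) * \<psi> n)"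

definition fib_spectrum :: "real \<Rightarrow> real set" where
  "fib_spectrum lam = {E. \<not> (\<exists>G. (\<forall>\<psi>\<in>l2Z. G \<psi> \<in> l2Z)
       \<and> (\<forall>\<phi>\<in>l2Z. \<forall>\<psi>\<in>l2Z. \<forall>a b. G (\<lambda>n. a * \<phi> n + b * \<psi> n) = (\<lambda>n. a * G \<phi> n + b * G \<psi> n))
       \<and> (\<exists>C. \<forall>\<psi>\<in>l2Z. l2Z_norm (G \<psi>) \<le> C * l2Z_norm \<psi>)
       \<and> (\<forall>\<psi>\<in>l2Z. G (\<lambda>n. fib_op lam \<psi> n - complex_of_real E * \<psi> n) = \<psi>)
       \<and> (\<forall>\<psi>\<in>l2Z. (\<lambda>n. fib_op lam (G \<psi>) n - complex_of_real E * G \<psi> n) = \<psi>))}"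

definition hausdorff_pre :: "real \<Rightarrow> real \<Rightarrow> real set \<Rightarrow> ennreal" where
  "hausdorff_pre s \<delta> A = (INF U \<in> {U :: nat \<Rightarrow> real set. A \<subseteq> (\<Union>i. U i)
       \<and> (\<forall>i. bounded (U i) \<and> diameter (U i) \<le> \<delta>)}.
       (\<Sum>i. ennreal (diameter (U i) powr s)))"

definition hausdorff_measure :: "real \<Rightarrow> real set \<Rightarrow> ennreal" where
  "hausdorff_measure s A = (SUP \<delta> \<in> {0<..}. hausdorff_pre s \<delta> A)"

definition hausdorff_dim :: "real set \<Rightarrow> real" where
  "hausdorff_dim A = Inf {s. 0 \<le> s \<and> hausdorff_measure s A = 0}"

definition fib_A :: "real \<Rightarrow> int \<Rightarrow> real \<Rightarrow> real^2^2" where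
  "fib_A lam n E = vector [vector [fib_pot lam n - E, -1], vector [1, 0]]"

fun fib_T :: "real \<Rightarrow> nat \<Rightarrow> real \<Rightarrow> real^2^2" where
  "fib_T lam 0 E = mat 1"
| "fib_T lam (Suc N) E = fib_A lam (int (Suc N)) E ** fib_T lam N E"

definition opnorm2 :: "real^2^2 \<Rightarrow> real" where
  "opnorm2 M = onorm (\<lambda>x. M *v x)"

end

theory Submission
  imports Defs "HOL-Computational_Algebra.Polynomial" "HOL-Probability.Sinc_Integral"
begin

text \<open>
  The squared Hilbert--Schmidt norm of the transfer matrix is a polynomial in \<open>E\<close> of degree at
  most \<open>2N\<close>. By the hypothesis, its sublevel set at height \<open>2 N\<^sup>2\<^sup>\<theta>\<close> contains the spectrum, and it
  consists of at most \<open>2N\<close> intervals since each of them starts at a root. As \<open>\<xi>\<close> lies below the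
  Hausdorff dimension, the \<open>\<xi>\<close>-th powers of the lengths of these intervals have a sum bounded away
  from zero, uniformly in \<open>N\<close>. Concavity of \<open>x \<mapsto> x\<^sup>\<xi>\<close> for \<open>\<xi> \<le> 1\<close> turns this into a lower
  bound of order \<open>N\<close> to the power \<open>1 - 1/\<xi>\<close> for the measure of the sublevel set, on which the
  integrand is at least \<open>1 / (2 N\<^sup>2\<^sup>\<theta>)\<close>.
\<close>

section \<open>Hausdorff measure and covers by intervals\<close>

lemma hausdorff_interval_cover:
  assumes "s > 0" and "hausdorff_measure s A \<noteq> 0"
  obtains \<kappa> where "\<kappa> > 0"
    and "\<And>Z (L :: real \<Rightarrow> real). \<lbrakk>finite Z; \<And>z. z \<in> Z \<Longrightarrow> 0 \<le> L z; A \<subseteq> (\<Union>z\<in>Z. {z..z + L z})\<rbrakk>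
           \<Longrightarrow> \<kappa> \<le> (\<Sum>z\<in>Z. L z powr s)"
proof -
  obtain \<delta> where \<delta>: "\<delta> > 0" "hausdorff_pre s \<delta> A \<noteq> 0"
  proof (rule ccontr)
    assume "\<not> thesis"
    then have "hausdorff_pre s \<delta> A = 0" if "\<delta> > 0" for \<delta>
      using that \<open>\<And>\<delta>. \<lbrakk>0 < \<delta>; hausdorff_pre s \<delta> A \<noteq> 0\<rbrakk> \<Longrightarrow> thesis\<close> by blast
    then have "hausdorff_measure s A \<le> 0"
      unfolding hausdorff_measure_def by (intro SUP_least) auto
    then show False using assms(2) by simp
  qed
  \<comment> \<open>Taken strictly below a possibly infinite value, so that \<open>c\<close> is
    finite.\<close>
  then obtain c where c: "0 < c" "c < hausdorff_pre s \<delta> A"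
    using dense[of 0 "hausdorff_pre s \<delta> A"] by (auto simp: zero_less_iff_neq_zero)
  define r where "r = enn2real c"
  have r: "r > 0" "c = ennreal r"
    using c top.not_eq_extremum[of c] order.strict_trans2[OF c(2) top_greatest]
    by (simp_all add: r_def enn2real_positive_iff)
  show ?thesis
  proof
    \<comment> \<open>The second entry forces every length to be at most \<open>\<delta>\<close>;
      the first then contradicts the choice of \<open>c\<close>.\<close>
    show "min r (\<delta> powr s) > 0" using r \<delta> by auto
    fix Z and L :: "real \<Rightarrow> real"
    assume Z: "finite Z" "\<And>z. z \<in> Z \<Longrightarrow> 0 \<le> L z" "A \<subseteq> (\<Union>z\<in>Z. {z..z + L z})"
    show "min r (\<delta> powr s) \<le> (\<Sum>z\<in>Z. L z powr s)"
    proof (rule ccontr)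
      assume "\<not> ?thesis"
      then have less: "(\<Sum>z\<in>Z. L z powr s) < r" "(\<Sum>z\<in>Z. L z powr s) < \<delta> powr s" by auto
      have small: "L z \<le> \<delta>" if "z \<in> Z" for z
      proof (rule ccontr)
        assume "\<not> L z \<le> \<delta>"
        then have "\<delta> powr s \<le> L z powr s" using \<delta> assms by (intro powr_mono2) auto
        also have "\<dots> \<le> (\<Sum>z\<in>Z. L z powr s)" using that Z by (intro member_le_sum) auto
        finally show False using less by simp
      qed
      obtain e where e: "bij_betw e {..<card Z} Z"
        using ex_bij_betw_nat_finite[OF Z(1)] by (auto simp: atLeast0LessThan)
      \<comment> \<open>\<open>hausdorff_pre\<close> asks for sequences, so the finite family is
        padded with empty sets, each adding \<open>0 powr s = 0\<close>.\<close>
      define U where "U i = (if i < card Z then {e i..e i + L (e i)} else {})" for i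
      have eZ: "e i \<in> Z" if "i < card Z" for i using e that by (auto simp: bij_betw_def)
      have diam: "diameter (U i) = (if i < card Z then L (e i) else 0)" for i
        using Z(2)[OF eZ, of i] by (auto simp: U_def diameter_closed_interval)
      have "A \<subseteq> (\<Union>i. U i)"
      proof
        fix x assume "x \<in> A"
        then obtain z where "z \<in> Z" "x \<in> {z..z + L z}" using Z by auto
        moreover obtain i where "i < card Z" "z = e i"
          using e \<open>z \<in> Z\<close> by (auto simp: bij_betw_def image_iff)
        ultimately show "x \<in> (\<Union>i. U i)" by (auto simp: U_def intro!: exI[of _ i])
      qed
      moreover have "bounded (U i)" "diameter (U i) \<le> \<delta>" for i
        using small[OF eZ, of i] \<delta> unfolding diam by (auto simp: U_def)
      ultimately have "hausdorff_pre s \<delta> A \<le> (\<Sum>i. ennreal (diameter (U i) powr s))"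
        unfolding hausdorff_pre_def by (intro INF_lower) auto
      also have "\<dots> = (\<Sum>i<card Z. ennreal (L (e i) powr s))"
        by (subst suminf_finite[of "{..<card Z}"]) (auto simp: diam)
      also have "\<dots> = ennreal (\<Sum>i<card Z. L (e i) powr s)" by simp
      also have "(\<Sum>i<card Z. L (e i) powr s) = (\<Sum>z\<in>Z. L z powr s)"
        by (rule sum.reindex_bij_betw[OF e])
      also have "ennreal \<dots> \<le> c" using less r by (auto intro: ennreal_leI)
      finally show False using c by simp
    qed
  qed
qed

text \<open>A grid of mesh proportional to \<open>1 / n\<close> gives a sum of order
  \<open>n powr (1 - s)\<close>, which tends to 0. This forces \<open>\<xi> \<le> 1\<close> later,
  the range where concavity holds.\<close>

lemma hausdorff_measure_zero_of_bounded:
  fixes A :: "real set"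
  assumes "s > 1" and "bounded A"
  shows "hausdorff_measure s A = 0"
proof (rule ccontr)
  assume "hausdorff_measure s A \<noteq> 0"
  with assms obtain \<kappa> where \<kappa>: "\<kappa> > 0"
    and cover: "\<And>Z (L :: real \<Rightarrow> real). \<lbrakk>finite Z; \<And>z. z \<in> Z \<Longrightarrow> 0 \<le> L z; A \<subseteq> (\<Union>z\<in>Z. {z..z + L z})\<rbrakk>
           \<Longrightarrow> \<kappa> \<le> (\<Sum>z\<in>Z. L z powr s)"
    using hausdorff_interval_cover[of s A] by auto
  obtain R where R: "R > 0" "\<And>x. x \<in> A \<Longrightarrow> \<bar>x\<bar> \<le> R"
    using assms(2) by (auto simp: bounded_pos)
  have bound: "\<kappa> \<le> 2 * (2 * R) powr s * real n powr - (s - 1)" if n: "n \<ge> 1" for n :: nat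
  proof -
    define h where "h = 2 * R / n"
    define g where "g k = - R + real k * h" for k :: nat
    have h: "h > 0" using R n by (simp add: h_def)
    \<comment> \<open>The index \<open>n\<close> is included for the endpoint \<open>x = R\<close>;
      the count \<open>n + 1\<close> is at most \<open>2 * n\<close>.\<close>
    have "A \<subseteq> (\<Union>z\<in>g ` {..n}. {z..z + h})"
    proof
      fix x assume "x \<in> A"
      define k where "k = nat \<lfloor>(x + R) / h\<rfloor>"
      have nn: "0 \<le> (x + R) / h" using R(2)[OF \<open>x \<in> A\<close>] h by auto
      then have k: "real k \<le> (x + R) / h" "(x + R) / h < real k + 1"
        unfolding k_def by simp_all
      have "(x + R) / h \<le> real n"
        using R(2)[OF \<open>x \<in> A\<close>] R n by (simp add: h_def field_simps)
      with k have "k \<le> n" by linarith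
      moreover have "x \<in> {g k..g k + h}" using k h by (simp add: g_def field_simps)
      ultimately show "x \<in> (\<Union>z\<in>g ` {..n}. {z..z + h})" by blast
    qed
    then have "\<kappa> \<le> (\<Sum>z\<in>g ` {..n}. h powr s)" using h by (intro cover) auto
    also have "\<dots> = real (card (g ` {..n})) * h powr s" by simp
    also have "\<dots> \<le> real (2 * n) * h powr s"
      using card_image_le[of "{..n}" g] n by (intro mult_right_mono) auto
    also have "\<dots> = 2 * (2 * R) powr s * (real n * real n powr - s)"
      using R n by (simp add: h_def powr_divide powr_minus_divide)
    also have "real n * real n powr - s = real n powr - (s - 1)"
      using n powr_add[of "real n" 1 "- s"] by simp
    finally show ?thesis .
  qed
  have "(\<lambda>n. 2 * (2 * R) powr s * real n powr - (s - 1)) \<longlonglongrightarrow> 2 * (2 * R) powr s * 0"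
    using assms by (intro tendsto_mult tendsto_const tendsto_neg_powr filterlim_real_sequentially) auto
  then have "\<kappa> \<le> 2 * (2 * R) powr s * 0"
    by (rule LIMSEQ_le_const) (use bound in blast)
  with \<kappa> show False by simp
qed

section \<open>Sublevel sets of a polynomial as unions of intervals\<close>

text \<open>Boundedness makes \<open>q\<close> positive far to the left, so each point of the
  sublevel set has a root at or before it. Grouping points by the last such root gives disjoint
  intervals, and their measures serve as the lengths.\<close>

lemma poly_sublevel_interval_cover:
  fixes q :: "real poly"
  assumes bdd: "bounded {x. poly q x \<le> 0}"
  obtains L where "\<And>z. 0 \<le> L z"
    and "{x. poly q x \<le> 0} \<subseteq> (\<Union>z\<in>{x. poly q x = 0}. {z..z + L z})"
    and "(\<Sum>z | poly q z = 0. L z) = measure lborel {x. poly q x \<le> 0}"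
proof -
  define S where "S = {x. poly q x \<le> 0}"
  define Z where "Z = {x. poly q x = 0}"
  \<comment> \<open>The part of the sublevel set whose nearest root to the left is \<open>z\<close>.\<close>
  define J where "J z = {x \<in> S. z \<le> x \<and> (\<forall>w\<in>Z. z < w \<longrightarrow> x < w)}" for z
  \<comment> \<open>The zero polynomial would have the whole line as sublevel set.\<close>
  have "q \<noteq> 0" using bdd not_bounded_UNIV by auto
  then have fin: "finite Z" unfolding Z_def by (rule poly_roots_finite)
  have root: "\<exists>w\<in>Z. t < w \<and> w \<le> x" if "poly q t > 0" "x \<in> S" "t < x" for t x
    using poly_IVT_neg[of t x q] that by (cases "poly q x = 0") (auto simp: S_def Z_def)
  have S_Un: "S = (\<Union>z\<in>Z. J z)"
  proof
    show "S \<subseteq> (\<Union>z\<in>Z. J z)"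
    proof
      fix x assume "x \<in> S"
      obtain b where b: "\<And>y. y \<in> S \<Longrightarrow> \<bar>y\<bar> \<le> b"
        using bdd unfolding S_def bounded_iff by auto
      \<comment> \<open>A point to the left of all of \<open>S\<close>, where \<open>q\<close> is
        therefore positive.\<close>
      define t where "t = - \<bar>b\<bar> - 1"
      have "t < x" using b[OF \<open>x \<in> S\<close>] by (auto simp: t_def)
      moreover have "poly q t > 0" using b[of t] by (force simp: t_def S_def)
      ultimately obtain w where "w \<in> {w \<in> Z. w \<le> x}" using root \<open>x \<in> S\<close> by blast
      then have m: "Max {w \<in> Z. w \<le> x} \<in> {w \<in> Z. w \<le> x}"
        using fin by (intro Max_in) auto
      moreover have "x < w" if "w \<in> Z" "Max {w \<in> Z. w \<le> x} < w" for w
      proof (rule ccontr)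
        assume "\<not> x < w"
        then have "w \<le> Max {w \<in> Z. w \<le> x}" using fin that by (intro Max_ge) auto
        then show False using that by simp
      qed
      ultimately show "x \<in> (\<Union>z\<in>Z. J z)" using \<open>x \<in> S\<close> by (auto simp: J_def)
    qed
  qed (auto simp: J_def)
  \<comment> \<open>Leaving \<open>S\<close> between \<open>z\<close> and \<open>x\<close> would
    require re-entering it at a root after \<open>z\<close>, which \<open>x \<in> J z\<close>
    excludes.\<close>
  have interval: "{z..x} \<subseteq> J z" if zx: "z \<in> Z" "x \<in> J z" for z x
  proof
    fix t assume t: "t \<in> {z..x}"
    have "poly q t \<le> 0"
    proof (rule ccontr)
      assume "\<not> poly q t \<le> 0"
      moreover from this have "t < x" using t zx by (cases "t = x") (auto simp: J_def S_def)
      ultimately obtain w where "w \<in> Z" "t < w" "w \<le> x"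
        using root[of t x] zx by (auto simp: J_def)
      then show False using t zx by (force simp: J_def)
    qed
    then show "t \<in> J z" using t zx by (force simp: J_def S_def)
  qed
  have "closed S" unfolding S_def by (intro closed_Collect_le continuous_intros)
  have meas: "J z \<in> sets lborel" for z
  proof -
    have "J z = S \<inter> {z..} \<inter> (\<Inter>w\<in>Z. if z < w then {..<w} else UNIV)"
      by (auto simp: J_def split: if_splits)
    also have "\<dots> \<in> sets borel"
    proof (cases "Z = {}")
      case False
      then show ?thesis using fin \<open>closed S\<close>
        by (intro sets.Int sets.finite_INT) (auto simp: borel_closed)
    qed (use \<open>closed S\<close> in \<open>auto simp: borel_closed\<close>)
    finally show ?thesis by simp
  qed
  have "J z \<subseteq> S" for z by (auto simp: J_def)
  then have bddJ: "bounded (J z)" for z using bdd bounded_subset unfolding S_def by blast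
  then have fm: "J z \<in> fmeasurable lborel" for z
    using meas emeasure_bounded_finite[of "J z"] by (auto simp: fmeasurable_def)
  show ?thesis
  proof
    show "0 \<le> measure lborel (J z)" for z by simp
    have "x \<in> {z..z + measure lborel (J z)}" if "z \<in> Z" "x \<in> J z" for x z
    proof -
      have "z \<le> x" using that by (simp add: J_def)
      moreover have "measure lborel {z..x} \<le> measure lborel (J z)"
        using interval[OF that] fm by (intro measure_mono_fmeasurable) auto
      ultimately show ?thesis by simp
    qed
    then show "{x. poly q x \<le> 0} \<subseteq> (\<Union>z\<in>{x. poly q x = 0}. {z..z + measure lborel (J z)})"
      unfolding S_def[symmetric] Z_def[symmetric] by (subst S_Un) blast
    have "disjoint_family_on J Z"
      unfolding disjoint_family_on_def
    proof (intro ballI impI)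
      fix z w assume zw: "z \<in> Z" "w \<in> Z" "z \<noteq> w"
      then have "z < w \<or> w < z" by auto
      then show "J z \<inter> J w = {}" using zw by (force simp: J_def)
    qed
    then have "measure lborel (\<Union>z\<in>Z. J z) = (\<Sum>z\<in>Z. measure lborel (J z))"
      using fin meas fm by (intro measure_finite_Union) (auto simp: fmeasurable_def less_top)
    then show "(\<Sum>z | poly q z = 0. measure lborel (J z)) = measure lborel {x. poly q x \<le> 0}"
      unfolding S_def[symmetric] Z_def[symmetric] S_Un[symmetric] by simp
  qed
qed

section \<open>From sums of powers to sums of lengths\<close>

lemma powr_le_powr_add_linear:
  fixes x t s :: real
  assumes "0 \<le> x" "0 < t" "0 < s" "s \<le> 1"
  shows "x powr s \<le> t powr s + t powr (s - 1) * x"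
proof (cases "x \<le> t")
  case True
  then have "x powr s \<le> t powr s" using assms by (intro powr_mono2) auto
  then show ?thesis using assms by (simp add: add_increasing2)
next
  case False
  then have "x powr s = x powr (s - 1) * x" using assms powr_add[of x "s - 1" 1] by simp
  also have "\<dots> \<le> t powr (s - 1) * x"
    using assms False by (intro mult_right_mono powr_mono2') auto
  finally show ?thesis by (simp add: add_increasing)
qed

text \<open>A power mean inequality up to a constant: the terms \<open>t powr s\<close> absorb at
  most half of \<open>\<kappa>\<close>, and what remains is linear in the lengths.\<close>

lemma sum_ge_of_sum_powr_ge:
  fixes L :: "'a \<Rightarrow> real"
  assumes s: "0 < s" "s \<le> 1" and m: "m > 0" "real (card Z) \<le> m" and \<kappa>: "\<kappa> > 0"
    and L: "\<And>z. z \<in> Z \<Longrightarrow> 0 \<le> L z" and ge: "\<kappa> \<le> (\<Sum>z\<in>Z. L z powr s)"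
  shows "\<kappa> / 2 * (\<kappa> / (2 * m)) powr (1 / s - 1) \<le> (\<Sum>z\<in>Z. L z)"
proof -
  \<comment> \<open>The threshold for which the lengths below it contribute at most \<open>\<kappa> / 2\<close>.\<close>
  define t where "t = (\<kappa> / (2 * m)) powr (1 / s)"
  have t: "t > 0" using \<kappa> m by (simp add: t_def)
  have ts: "t powr s = \<kappa> / (2 * m)" using \<kappa> m s by (simp add: t_def powr_powr)
  have "\<kappa> \<le> (\<Sum>z\<in>Z. t powr s + t powr (s - 1) * L z)"
    using ge by (rule order.trans) (intro sum_mono powr_le_powr_add_linear L t s)
  also have "\<dots> = real (card Z) * t powr s + t powr (s - 1) * (\<Sum>z\<in>Z. L z)"
    by (simp add: sum.distrib sum_distrib_left)
  also have "real (card Z) * t powr s \<le> m * t powr s" using m by (intro mult_right_mono) auto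
  also have "m * t powr s = \<kappa> / 2" using m by (simp add: ts)
  finally have "\<kappa> / 2 \<le> t powr (s - 1) * (\<Sum>z\<in>Z. L z)" by simp
  then have "\<kappa> / 2 * t powr (1 - s) \<le> (t powr (s - 1) * (\<Sum>z\<in>Z. L z)) * t powr (1 - s)"
    by (intro mult_right_mono) auto
  also have "\<dots> = (\<Sum>z\<in>Z. L z)"
    using t powr_add[of t "s - 1" "1 - s"] by (simp add: mult_ac)
  also have "t powr (1 - s) = (\<kappa> / (2 * m)) powr (1 / s - 1)"
    using s by (simp add: t_def powr_powr field_simps)
  finally show ?thesis .
qed

section \<open>Operator norm and Hilbert--Schmidt norm\<close>

text \<open>The norm of a matrix type is the Hilbert--Schmidt norm; Cauchy--Schwarz applies row by
  row.\<close>

lemma norm_matrix_vector_mult_le: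
  fixes A :: "real^'n^'m"
  shows "norm (A *v x) \<le> norm A * norm x"
proof -
  have "norm (A *v x) = L2_set (\<lambda>i. norm ((A $ i) \<bullet> x)) UNIV"
    by (simp add: norm_vec_def matrix_vector_mul_component)
  also have "\<dots> \<le> L2_set (\<lambda>i. norm (A $ i) * norm x) UNIV"
    by (intro L2_set_mono) (auto simp: Cauchy_Schwarz_ineq2)
  also have "\<dots> = norm A * norm x"
    by (simp add: norm_vec_def[of A] L2_set_left_distrib)
  finally show ?thesis .
qed

lemma opnorm2_le_norm: "opnorm2 A \<le> norm A"
  unfolding opnorm2_def by (intro onorm_bound norm_matrix_vector_mult_le) auto

lemma norm_column_le_opnorm2: "norm (column j A) \<le> opnorm2 A"
  using onorm[of "(*v) A" "axis j 1"]
  by (simp add: opnorm2_def matrix_vector_mult_basis norm_axis_1)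

lemma entry_le_opnorm2: "\<bar>A $ i $ j\<bar> \<le> opnorm2 A"
  using component_le_norm_cart[of "column j A" i] norm_column_le_opnorm2[of j A]
  by (simp add: column_def)

lemma opnorm2_nonneg: "0 \<le> opnorm2 A"
  using entry_le_opnorm2[of A 1 1] by linarith

lemma norm_matrix2_squared:
  "(norm (A :: real^2^2))\<^sup>2 = (A$1$1)\<^sup>2 + (A$1$2)\<^sup>2 + (A$2$1)\<^sup>2 + (A$2$2)\<^sup>2"
  unfolding power2_norm_eq_inner
  by (simp only: inner_vec_def sum_2 inner_real_def power2_eq_square add.assoc)

text \<open>The factor 2 counts the columns. The comparison allows the operator norm to be replaced
  by a quantity polynomial in the entries.\<close>

lemma norm_squared_le_opnorm2: "(norm A)\<^sup>2 \<le> 2 * (opnorm2 A)\<^sup>2"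
proof -
  have "(norm (column j A))\<^sup>2 \<le> (opnorm2 A)\<^sup>2" for j
    by (intro power_mono norm_column_le_opnorm2) auto
  from this[of 1] this[of 2] show ?thesis
    by (simp add: norm_matrix2_squared norm_vec_def[where 'b = 2] L2_set_def sum_2 column_def
        add_nonneg_nonneg)
qed

text \<open>Measurability of the integrand rests on this; the triangle inequality gives Lipschitz
  constant 1.\<close>

lemma continuous_on_opnorm2: "continuous_on UNIV opnorm2"
proof -
  have le: "opnorm2 A \<le> opnorm2 B + norm (A - B)" for A B
  proof -
    have "opnorm2 (B + (A - B)) \<le> opnorm2 B + opnorm2 (A - B)"
      unfolding opnorm2_def matrix_vector_mult_add_rdistrib
      by (intro onorm_triangle) auto
    then show ?thesis using opnorm2_le_norm[of "A - B"] by simp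
  qed
  have "1-lipschitz_on UNIV opnorm2"
  proof (rule lipschitz_onI)
    fix A B
    show "dist (opnorm2 A) (opnorm2 B) \<le> 1 * dist A B"
      using le[of A B] le[of B A] by (auto simp: dist_norm norm_minus_commute)
  qed auto
  then show ?thesis by (rule lipschitz_on_continuous_on)
qed

section \<open>Transfer matrices: determinant, polynomial entries, growth in the energy\<close>

lemma abs_fib_pot_le: "lam \<ge> 0 \<Longrightarrow> \<bar>fib_pot lam n\<bar> \<le> lam"
  by (auto simp: fib_pot_def indicator_def)

lemma fib_T_Suc_nth:
  "fib_T lam (Suc N) E $ 1 $ j
     = (fib_pot lam (int (Suc N)) - E) * fib_T lam N E $ 1 $ j - fib_T lam N E $ 2 $ j"
  "fib_T lam (Suc N) E $ 2 $ j = fib_T lam N E $ 1 $ j"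
  unfolding fib_T.simps fib_A_def matrix_matrix_mult_def
  by (simp_all add: sum_2 del: of_nat_Suc)

declare fib_T.simps(2) [simp del]

lemma det_fib_T: "det (fib_T lam N E) = 1"
proof (induction N)
  case (Suc N)
  have "det (fib_A lam (int (Suc N)) E) = 1" by (simp add: det_2 fib_A_def)
  then show ?case using Suc by (simp add: fib_T.simps(2) det_mul)
qed simp

lemma opnorm2_fib_T_ge_1: "1 \<le> (opnorm2 (fib_T lam N E))\<^sup>2"
proof -
  \<comment> \<open>\<open>(norm A)\<^sup>2 - 2 * det A\<close> is the sum of the squares of
    \<open>A$1$1 - A$2$2\<close> and \<open>A$1$2 + A$2$1\<close>.\<close>
  have two: "2 * det A \<le> (norm A)\<^sup>2" for A :: "real^2^2"
    using sum_squares_bound[of "A$1$1" "A$2$2"] sum_squares_bound[of "A$1$2" "- (A$2$1)"]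
    by (simp add: norm_matrix2_squared det_2)
  then show ?thesis
    using two[of "fib_T lam N E"] norm_squared_le_opnorm2[of "fib_T lam N E"]
    by (simp add: det_fib_T)
qed

text \<open>Each factor \<open>fib_A\<close> is affine in \<open>E\<close>, so one step raises the
  degree by at most one.\<close>

lemma fib_T_poly:
  obtains P where "\<And>i j E. fib_T lam N E $ i $ j = poly (P i j) E" "\<And>i j. degree (P i j) \<le> N"
proof -
  have "\<exists>P. (\<forall>i j E. fib_T lam N E $ i $ j = poly (P i j) E) \<and> (\<forall>i j. degree (P i j) \<le> N)"
  proof (induction N)
    case 0
    show ?case
      by (rule exI[of _ "\<lambda>i j. [:mat 1 $ i $ j:]"]) auto
  next
    case (Suc N)
    then obtain P where P: "\<And>i j E. fib_T lam N E $ i $ j = poly (P i j) E"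
      "\<And>i j. degree (P i j) \<le> N" by auto
    define Q where "Q i j = (if i = 1 then [:fib_pot lam (int (Suc N)), -1:] * P 1 j - P 2 j else P 1 j)"
      for i j :: 2
    have "fib_T lam (Suc N) E $ i $ j = poly (Q i j) E" for i j E
      using exhaust_2[of i] by (auto simp: Q_def fib_T_Suc_nth P algebra_simps)
    moreover have "degree (Q i j) \<le> Suc N" for i j
    proof -
      have "degree ([:fib_pot lam (int (Suc N)), -1:] * P 1 j) \<le> 1 + N"
        by (rule order.trans[OF degree_mult_le]) (use P(2) in auto)
      then show ?thesis using P(2)[of 1 j] P(2)[of 2 j] by (auto simp: Q_def intro!: degree_diff_le)
    qed
    ultimately show ?case by blast
  qed
  then show ?thesis using that by blast
qed

lemma continuous_on_fib_T: "continuous_on UNIV (fib_T lam N)"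
proof -
  obtain P where "\<And>i j E. fib_T lam N E $ i $ j = poly (P i j) E" "\<And>i j. degree (P i j) \<le> N"
    using fib_T_poly[of lam N] by blast
  then have "fib_T lam N = (\<lambda>E. \<chi> i j. poly (P i j) E)" by (auto simp: vec_eq_iff)
  then show ?thesis by (auto intro!: continuous_intros)
qed

text \<open>The recursion coefficient has modulus at least 2, so the upper entry of the first column
  never shrinks and keeps dominating the lower one. The index starts at \<open>Suc N\<close> because
  the identity matrix violates the first bound.\<close>

lemma fib_T_growth:
  assumes "lam \<ge> 0" "\<bar>E\<bar> \<ge> lam + 2"
  shows "\<bar>fib_T lam (Suc N) E $ 1 $ 1\<bar> \<ge> \<bar>E\<bar> - lam
       \<and> \<bar>fib_T lam (Suc N) E $ 2 $ 1\<bar> \<le> \<bar>fib_T lam (Suc N) E $ 1 $ 1\<bar>"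
proof (induction N)
  case 0
  have "\<bar>fib_pot lam (int (Suc 0)) - E\<bar> \<ge> \<bar>E\<bar> - lam"
    using abs_fib_pot_le[OF assms(1), of "int (Suc 0)"] by linarith
  then show ?case using assms by (simp add: fib_T_Suc_nth mat_def)
next
  case (Suc N)
  let ?a = "fib_T lam (Suc N) E $ 1 $ 1" and ?b = "fib_T lam (Suc N) E $ 2 $ 1"
  let ?c = "fib_pot lam (int (Suc (Suc N))) - E"
  have "\<bar>?c\<bar> \<ge> 2"
    using abs_fib_pot_le[OF assms(1), of "int (Suc (Suc N))"] assms by linarith
  then have "2 * \<bar>?a\<bar> \<le> \<bar>?c\<bar> * \<bar>?a\<bar>" by (intro mult_right_mono) auto
  then have "\<bar>?a\<bar> \<le> \<bar>?c * ?a - ?b\<bar>"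
    using Suc abs_triangle_ineq2[of "?c * ?a" ?b] unfolding abs_mult by linarith
  then show ?case using Suc
    unfolding fib_T_Suc_nth(1)[of lam "Suc N"] fib_T_Suc_nth(2)[of lam "Suc N"] by linarith
qed

text \<open>Serves both integrability and boundedness of sublevel sets. The constant adds one that
  works for large energies to one that works for bounded energies.\<close>

lemma opnorm2_fib_T_quadratic_growth:
  assumes "lam \<ge> 0" "N \<ge> 1"
  shows "1 + E\<^sup>2 \<le> (2 * (1 + lam)\<^sup>2 + (1 + (lam + 2)\<^sup>2)) * (opnorm2 (fib_T lam N E))\<^sup>2"
proof (cases "\<bar>E\<bar> \<ge> lam + 2")
  case True
  let ?o = "opnorm2 (fib_T lam N E)"
  obtain n where n: "N = Suc n" using assms by (cases N) auto
  have o: "\<bar>E\<bar> - lam \<le> ?o"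
    using fib_T_growth[OF assms(1) True, of n] entry_le_opnorm2[of "fib_T lam N E" 1 1]
    by (simp add: n)
  \<comment> \<open>This product is the difference of the two sides of the next inequality.\<close>
  have "0 \<le> lam * (\<bar>E\<bar> - 1 - lam)" using True assms by (intro mult_nonneg_nonneg) auto
  then have "\<bar>E\<bar> \<le> (1 + lam) * (\<bar>E\<bar> - lam)" by (simp add: algebra_simps)
  also have "\<dots> \<le> (1 + lam) * ?o" using o assms by (intro mult_left_mono) auto
  finally have "\<bar>E\<bar>\<^sup>2 \<le> ((1 + lam) * ?o)\<^sup>2" by (intro power_mono) auto
  then have "E\<^sup>2 \<le> (1 + lam)\<^sup>2 * ?o\<^sup>2" by (simp add: power_mult_distrib)
  \<comment> \<open>Bounding \<open>1 + E\<^sup>2\<close> by \<open>2 * E\<^sup>2\<close> produces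
    the factor 2 in the constant.\<close>
  moreover have "1 \<le> E\<^sup>2" using True assms power_mono[of 1 "\<bar>E\<bar>" 2] by simp
  moreover have "0 \<le> (1 + (lam + 2)\<^sup>2) * ?o\<^sup>2" by simp
  ultimately have "1 + E\<^sup>2 \<le> 2 * ((1 + lam)\<^sup>2 * ?o\<^sup>2) + (1 + (lam + 2)\<^sup>2) * ?o\<^sup>2"
    by linarith
  then show ?thesis by (simp only: distrib_right mult.assoc)
next
  case False
  then have "\<bar>E\<bar>\<^sup>2 \<le> (lam + 2)\<^sup>2" by (intro power_mono) auto
  then have "1 + E\<^sup>2 \<le> (2 * (1 + lam)\<^sup>2 + (1 + (lam + 2)\<^sup>2)) * 1"
    using zero_le_power2[of "1 + lam"] power2_abs[of E]
    unfolding mult_1_right by linarith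
  also have "\<dots> \<le> (2 * (1 + lam)\<^sup>2 + (1 + (lam + 2)\<^sup>2)) * (opnorm2 (fib_T lam N E))\<^sup>2"
    by (intro mult_left_mono opnorm2_fib_T_ge_1) auto
  finally show ?thesis .
qed

text \<open>Without integrability the Bochner integral would be the junk value 0.\<close>

lemma integrable_inverse_opnorm2_fib_T:
  assumes "lam \<ge> 0" "N \<ge> 1"
  shows "integrable lborel (\<lambda>E. 1 / (opnorm2 (fib_T lam N E))\<^sup>2)"
proof -
  define K where "K = 2 * (1 + lam)\<^sup>2 + (1 + (lam + 2)\<^sup>2)"
  have K: "1 + E\<^sup>2 \<le> K * (opnorm2 (fib_T lam N E))\<^sup>2" for E
    unfolding K_def by (rule opnorm2_fib_T_quadratic_growth[OF assms])
  have "integrable lborel (\<lambda>E::real. inverse (1 + E\<^sup>2))"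
    using integrable_inverse_1_plus_square by (simp add: set_integrable_def)
  then have "integrable lborel (\<lambda>E. K * inverse (1 + E\<^sup>2))" by simp
  moreover have "(\<lambda>E. 1 / (opnorm2 (fib_T lam N E))\<^sup>2) \<in> borel_measurable lborel"
  proof -
    have "continuous_on UNIV (\<lambda>E. opnorm2 (fib_T lam N E))"
      using continuous_on_compose2[OF continuous_on_opnorm2 continuous_on_fib_T] by simp
    then have "(\<lambda>E. opnorm2 (fib_T lam N E)) \<in> borel_measurable borel"
      by (rule borel_measurable_continuous_onI)
    then show ?thesis by simp
  qed
  moreover have "norm (1 / (opnorm2 (fib_T lam N E))\<^sup>2) \<le> norm (K * inverse (1 + E\<^sup>2))" for E
  proof -
    have "0 < 1 + E\<^sup>2" by (simp add: add_pos_nonneg)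
    moreover have "0 < (opnorm2 (fib_T lam N E))\<^sup>2" using opnorm2_fib_T_ge_1[of lam N E] by linarith
    ultimately have "1 / (opnorm2 (fib_T lam N E))\<^sup>2 \<le> K * inverse (1 + E\<^sup>2)"
      using K[of E] by (simp add: field_simps)
    then show ?thesis by simp
  qed
  ultimately show ?thesis by (rule Bochner_Integration.integrable_bound[OF _ _ AE_I2])
qed

lemma fib_T_sublevel_bounded:
  assumes "lam \<ge> 0" "N \<ge> 1"
  shows "bounded {E. (norm (fib_T lam N E))\<^sup>2 \<le> c}"
proof -
  define K where "K = 2 * (1 + lam)\<^sup>2 + (1 + (lam + 2)\<^sup>2)"
  have "\<bar>E\<bar> \<le> sqrt (K * c)" if "(norm (fib_T lam N E))\<^sup>2 \<le> c" for E
  proof (rule real_le_rsqrt)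
    have "1 + E\<^sup>2 \<le> K * (opnorm2 (fib_T lam N E))\<^sup>2"
      unfolding K_def by (rule opnorm2_fib_T_quadratic_growth[OF assms])
    also have "\<dots> \<le> K * (norm (fib_T lam N E))\<^sup>2"
      by (intro mult_left_mono power_mono opnorm2_le_norm opnorm2_nonneg) (auto simp: K_def)
    also have "\<dots> \<le> K * c" using that by (intro mult_left_mono) (auto simp: K_def)
    finally show "\<bar>E\<bar>\<^sup>2 \<le> K * c" by simp
  qed
  then show ?thesis by (auto simp: bounded_iff)
qed

section \<open>The lower bound for the integral\<close>

theorem theorem3p11:
  fixes lam \<theta> :: real
  assumes "lam > 0" and "\<theta> > 0"
    and "\<forall>N::nat. N \<ge> 2 \<longrightarrow> (\<forall>E \<in> fib_spectrum lam. opnorm2 (fib_T lam N E) \<le> real N powr \<theta>)"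
  shows "\<forall>\<xi>. 0 < \<xi> \<and> \<xi> < hausdorff_dim (fib_spectrum lam) \<longrightarrow>
           (\<exists>C > 0. \<forall>N::nat. N \<ge> 2 \<longrightarrow>
              (\<integral>E. 1 / (opnorm2 (fib_T lam N E))\<^sup>2 \<partial>lborel)
                \<ge> C / real N powr ((1 / \<xi> - 1) + 2 * \<theta>))"
proof (intro allI impI)
  fix \<xi> assume \<xi>: "0 < \<xi> \<and> \<xi> < hausdorff_dim (fib_spectrum lam)"
  let ?\<Sigma> = "fib_spectrum lam"
  \<comment> \<open>The factor 2 pays for the passage from the operator norm to the Hilbert--Schmidt
    norm.\<close>
  define S where "S N = {E. (norm (fib_T lam N E))\<^sup>2 \<le> 2 * real N powr (2 * \<theta>)}" for N
  have spec: "?\<Sigma> \<subseteq> S N" if "N \<ge> 2" for N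
  proof
    fix E assume "E \<in> ?\<Sigma>"
    have "(norm (fib_T lam N E))\<^sup>2 \<le> 2 * (opnorm2 (fib_T lam N E))\<^sup>2"
      by (rule norm_squared_le_opnorm2)
    also have "\<dots> \<le> 2 * (real N powr \<theta>)\<^sup>2"
      using assms(3) that \<open>E \<in> ?\<Sigma>\<close> by (intro mult_left_mono power_mono opnorm2_nonneg) auto
    also have "(real N powr \<theta>)\<^sup>2 = real N powr (2 * \<theta>)"
      using that by (simp add: power2_eq_square flip: powr_add)
    finally show "E \<in> S N" by (simp add: S_def)
  qed
  have bddS: "bounded (S N)" if "N \<ge> 2" for N
    unfolding S_def using assms(1) that by (intro fib_T_sublevel_bounded) auto
  \<comment> \<open>Otherwise \<open>\<xi>\<close> would belong to the set whose infimum is the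
    dimension.\<close>
  have nz: "hausdorff_measure \<xi> ?\<Sigma> \<noteq> 0"
  proof
    assume "hausdorff_measure \<xi> ?\<Sigma> = 0"
    then have "hausdorff_dim ?\<Sigma> \<le> \<xi>"
      unfolding hausdorff_dim_def using \<xi> by (intro cInf_lower bdd_belowI[of _ 0]) auto
    with \<xi> show False by simp
  qed
  have "bounded ?\<Sigma>" using spec[of 2] bddS[of 2] bounded_subset by auto
  then have \<xi>1: "\<xi> \<le> 1" using hausdorff_measure_zero_of_bounded[of \<xi>] nz by force
  \<comment> \<open>Obtained before \<open>N\<close> is fixed, hence independent of it.\<close>
  obtain \<kappa> where \<kappa>: "\<kappa> > 0"
    and cover: "\<And>Z (L :: real \<Rightarrow> real).
        \<lbrakk>finite Z; \<And>z. z \<in> Z \<Longrightarrow> 0 \<le> L z; ?\<Sigma> \<subseteq> (\<Union>z\<in>Z. {z..z + L z})\<rbrakk>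
           \<Longrightarrow> \<kappa> \<le> (\<Sum>z\<in>Z. L z powr \<xi>)"
    using hausdorff_interval_cover[of \<xi> ?\<Sigma>] \<xi> nz by auto
  \<comment> \<open>The measure bound below, with \<open>m = 2 * N\<close>, divided by the height
    \<open>2 * N powr (2 * \<theta>)\<close>, after splitting off the powers of
    \<open>N\<close>.\<close>
  define C where "C = \<kappa> / 4 * (\<kappa> / 4) powr (1 / \<xi> - 1)"
  show "\<exists>C > 0. \<forall>N::nat. N \<ge> 2 \<longrightarrow>
              (\<integral>E. 1 / (opnorm2 (fib_T lam N E))\<^sup>2 \<partial>lborel)
                \<ge> C / real N powr ((1 / \<xi> - 1) + 2 * \<theta>)"
  proof (intro exI[of _ C] conjI allI impI)
    show "C > 0" using \<kappa> by (simp add: C_def)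
    fix N :: nat assume N: "N \<ge> 2"
    let ?c = "2 * real N powr (2 * \<theta>)" and ?f = "\<lambda>E. 1 / (opnorm2 (fib_T lam N E))\<^sup>2"
    have c: "?c > 0" using N by simp
    obtain P where P: "\<And>i j E. fib_T lam N E $ i $ j = poly (P i j) E"
      "\<And>i j. degree (P i j) \<le> N"
      using fib_T_poly[of lam N] by blast
    \<comment> \<open>The set where \<open>q\<close> is nonpositive is \<open>S N\<close>, and the
      degree of \<open>q\<close> bounds the number of intervals by \<open>2 * N\<close>.\<close>
    define q where "q = (P 1 1)\<^sup>2 + (P 1 2)\<^sup>2 + (P 2 1)\<^sup>2 + (P 2 2)\<^sup>2 - [:?c:]"
    have "poly q E = (norm (fib_T lam N E))\<^sup>2 - ?c" for E
      by (simp add: q_def norm_matrix2_squared P)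
    then have S: "S N = {E. poly q E \<le> 0}" by (simp add: S_def)
    have "degree ((P i j)\<^sup>2) \<le> 2 * N" for i j
      using degree_power_le[of "P i j" 2] P(2)[of i j] by simp
    then have deg: "degree q \<le> 2 * N"
      unfolding q_def by (intro degree_diff_le degree_add_le) auto
    have "q \<noteq> 0" using bddS[OF N] not_bounded_UNIV unfolding S by auto
    then have fin: "finite {z. poly q z = 0}" and card: "card {z. poly q z = 0} \<le> 2 * N"
      using poly_roots_finite card_poly_roots_bound deg order.trans by blast+
    have "bounded {E. poly q E \<le> 0}" using bddS[OF N] unfolding S .
    then obtain L where L: "\<And>z. 0 \<le> L z"
      "{E. poly q E \<le> 0} \<subseteq> (\<Union>z\<in>{z. poly q z = 0}. {z..z + L z})"
      "(\<Sum>z | poly q z = 0. L z) = measure lborel {E. poly q E \<le> 0}"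
      by (rule poly_sublevel_interval_cover) (rule that)
    have "\<kappa> \<le> (\<Sum>z | poly q z = 0. L z powr \<xi>)"
      using L(1) fin order.trans[OF spec[OF N, unfolded S] L(2)] by (intro cover)
    then have "\<kappa> / 2 * (\<kappa> / (2 * real (2 * N))) powr (1 / \<xi> - 1) \<le> (\<Sum>z | poly q z = 0. L z)"
      using \<xi> \<xi>1 N card \<kappa> L(1) by (intro sum_ge_of_sum_powr_ge) auto
    then have meas: "\<kappa> / 2 * (\<kappa> / (4 * N)) powr (1 / \<xi> - 1) \<le> measure lborel (S N)"
      by (simp add: L(3) S)
    have "closed (S N)" unfolding S by (intro closed_Collect_le continuous_intros)
    then have Sb: "S N \<in> sets borel" by (rule borel_closed)
    have Sf: "emeasure lborel (S N) < \<infinity>" by (rule emeasure_bounded_finite[OF bddS[OF N]])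
    have "C / real N powr ((1 / \<xi> - 1) + 2 * \<theta>)
        = \<kappa> / 2 * (\<kappa> / (4 * N)) powr (1 / \<xi> - 1) / ?c"
    proof -
      have "(\<kappa> / (4 * N)) powr (1 / \<xi> - 1) = (\<kappa> / 4) powr (1 / \<xi> - 1) / real N powr (1 / \<xi> - 1)"
        using \<kappa> N powr_divide[of "\<kappa> / 4" "real N" "1 / \<xi> - 1"] by simp
      then show ?thesis unfolding C_def powr_add by (simp add: field_simps)
    qed
    also have "\<dots> \<le> measure lborel (S N) / ?c" using meas c by (intro divide_right_mono) auto
    also have "\<dots> = (\<integral>E. indicator (S N) E / ?c \<partial>lborel)" using Sb Sf by simp
    \<comment> \<open>On \<open>S N\<close> the squared operator norm is at most \<open>?c\<close>;
      elsewhere the integrand is nonnegative.\<close>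
    also have "\<dots> \<le> (\<integral>E. ?f E \<partial>lborel)"
    proof (rule integral_mono)
      show "integrable lborel (\<lambda>E. indicator (S N) E / ?c)" using Sb Sf by simp
      show "integrable lborel ?f"
        using assms(1) N by (intro integrable_inverse_opnorm2_fib_T) auto
      fix E
      have "0 < (opnorm2 (fib_T lam N E))\<^sup>2" using opnorm2_fib_T_ge_1[of lam N E] by linarith
      moreover have "(opnorm2 (fib_T lam N E))\<^sup>2 \<le> (norm (fib_T lam N E))\<^sup>2"
        by (intro power_mono opnorm2_le_norm opnorm2_nonneg)
      ultimately show "indicator (S N) E / ?c \<le> ?f E"
        using c by (auto simp: indicator_def S_def intro!: divide_left_mono mult_pos_pos)
    qed
    finally show "(\<integral>E. ?f E \<partial>lborel) \<ge> C / real N powr ((1 / \<xi> - 1) + 2 * \<theta>)" .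
  qed
qed

end
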